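(* Let $f:\mathbb{R}^+\to\mathbb{R}^+$ be a standard matrix monotone function, let $\lambda_1,\dots,\lambda_n$ be strictly positive numbers, and let $T\in\mathbf{M}_n$ be the matrix with entries $T_{ij}=\dfrac{1}{m_f(\lambda_i,\lambda_j)}$. Then the linear mapping $\beta:\mathbf{M}_n\to\mathbf{M}_n$, $\beta(A)=A\circ T$, is completely positive if and only if the matrix $T$ is positive.
   Context: $\mathbb{R}^+=(0,\infty)$ and $\mathbf{M}_n$ is the algebra of $n\times n$ complex matrices; a matrix is called positive if it is positive semidefinite. $A\circ T$ denotes the Hadamard (entrywise) product. A matrix monotone function $f:\mathbb{R}^+\to\mathbb{R}^+$ (i.e. $A\le B$ implies $f(A)\le f(B)$ for positive definite matrices of every size) is called standard if $f(1)=1$ and $t f(t^{-1})=f(t)$ for all $t>0$. For such $f$, $m_f(x,y)=x f(y/x)$ for $x,y>0$. *)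

theory Defs
  imports "Jordan_Normal_Form.Schur_Decomposition"
begin

text \<open>Matrices are complex matrices with explicit dimensions, indexed from 0. The comparisons with
  0 below use the order of \<^theory>\<open>HOL-Library.Complex_Order\<close>, so they include the claim that the
  quadratic form is real, which over the complex numbers forces the matrix to be Hermitian.\<close>

definition positive_semidef :: "nat \<Rightarrow> complex mat \<Rightarrow> bool" where
  "positive_semidef n A \<longleftrightarrow>
     A \<in> carrier_mat n n \<and> (\<forall>v \<in> carrier_vec n. 0 \<le> (A *\<^sub>v v) \<bullet>c v)"

definition positive_def :: "nat \<Rightarrow> complex mat \<Rightarrow> bool" where
  "positive_def n A \<longleftrightarrow>
     A \<in> carrier_mat n n \<and> (\<forall>v \<in> carrier_vec n. v \<noteq> 0\<^sub>v n \<longrightarrow> 0 < (A *\<^sub>v v) \<bullet>c v)"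

definition loewner_le :: "nat \<Rightarrow> complex mat \<Rightarrow> complex mat \<Rightarrow> bool" where
  "loewner_le n A B \<longleftrightarrow>
     A \<in> carrier_mat n n \<and> B \<in> carrier_mat n n \<and> positive_semidef n (B - A)"

definition unitary_mat :: "nat \<Rightarrow> complex mat \<Rightarrow> bool" where
  "unitary_mat n U \<longleftrightarrow>
     U \<in> carrier_mat n n \<and> mat_adjoint U * U = 1\<^sub>m n \<and> U * mat_adjoint U = 1\<^sub>m n"

definition spectral_form :: "nat \<Rightarrow> complex mat \<Rightarrow> (nat \<Rightarrow> real) \<Rightarrow> complex mat" where
  "spectral_form n U d = U * mat_diag n (\<lambda>i. complex_of_real (d i)) * mat_adjoint U"

text \<open>Functional calculus for Hermitian matrices. The value does not depend on the chosen
  diagonalization, see \<open>mat_fun_spectral_form\<close>.\<close>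

definition mat_fun :: "(real \<Rightarrow> real) \<Rightarrow> complex mat \<Rightarrow> complex mat" where
  "mat_fun f A = (THE B. \<exists>U d. unitary_mat (dim_row A) U \<and>
     A = spectral_form (dim_row A) U d \<and> B = spectral_form (dim_row A) U (f \<circ> d))"

lemma mat_adjoint_carrier [simp, intro]:
  "U \<in> carrier_mat n m \<Longrightarrow> mat_adjoint U \<in> carrier_mat m n"
  unfolding mat_adjoint_def by auto

lemma spectral_form_carrier:
  "unitary_mat n U \<Longrightarrow> spectral_form n U d \<in> carrier_mat n n"
  unfolding unitary_mat_def spectral_form_def
  by (intro mult_carrier_mat[of _ n n] mat_adjoint_carrier mat_diag_dim) auto

lemma spectral_form_unique:
  assumes U: "unitary_mat n U" and V: "unitary_mat n V"
    and eq: "spectral_form n U d = spectral_form n V e"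
  shows "spectral_form n U (f \<circ> d) = spectral_form n V (f \<circ> e)"
proof -
  let ?D = "\<lambda>d. mat_diag n (\<lambda>i. complex_of_real (d i))"
  let ?U' = "mat_adjoint U" and ?V' = "mat_adjoint V"
  have c: "U \<in> carrier_mat n n" "V \<in> carrier_mat n n" "?U' \<in> carrier_mat n n"
    "?V' \<in> carrier_mat n n" and cD: "\<And>d. ?D d \<in> carrier_mat n n"
    using U V unfolding unitary_mat_def by (auto simp: mat_diag_def)
  note m = mult_carrier_mat[of _ n n _ n]
  note assoc = assoc_mult_mat[of _ n n _ n _ n]
  have i: "?U' * U = 1\<^sub>m n" "?V' * V = 1\<^sub>m n" "U * ?U' = 1\<^sub>m n" "V * ?V' = 1\<^sub>m n"
    using U V unfolding unitary_mat_def by auto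
  define W where "W = ?V' * U"
  have W: "W \<in> carrier_mat n n" unfolding W_def by (intro m c)
  have VW: "V * W = U"
  proof -
    have "V * W = (V * ?V') * U" unfolding W_def by (rule assoc[symmetric]; intro m c cD W)
    then show ?thesis using i c by simp
  qed
  have WU: "W * ?U' = ?V'"
  proof -
    have "W * ?U' = ?V' * (U * ?U')" unfolding W_def by (rule assoc; intro m c cD W)
    then show ?thesis using i c by simp
  qed
  have L: "?V' * spectral_form n U d * U = W * ?D d" for d
  proof -
    have "?V' * spectral_form n U d * U = ?V' * (U * ?D d * ?U' * U)"
      unfolding spectral_form_def by (rule assoc; intro m c cD W)
    also have "U * ?D d * ?U' * U = U * ?D d * (?U' * U)"
      by (rule assoc; intro m c cD W)
    also have "\<dots> = U * ?D d" using i right_mult_one_mat[OF m[OF c(1) cD]] by simp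
    also have "?V' * (U * ?D d) = W * ?D d" unfolding W_def
      by (rule assoc[symmetric]; intro m c cD W)
    finally show ?thesis .
  qed
  have R: "?V' * spectral_form n V e * U = ?D e * W" for e
  proof -
    have "?V' * spectral_form n V e = ?V' * (V * (?D e * ?V'))"
      unfolding spectral_form_def using assoc[OF c(2) cD c(4)] by simp
    also have "\<dots> = (?V' * V) * (?D e * ?V')"
      by (rule assoc[symmetric]; intro m c cD W)
    also have "\<dots> = ?D e * ?V'" using i left_mult_one_mat[OF m[OF cD c(4)]] by simp
    finally show ?thesis unfolding W_def using assoc[OF cD c(4) c(1)] by simp
  qed
  have comm: "W * ?D d = ?D e * W" using L R eq by metis
  have "W * ?D (f \<circ> d) = ?D (f \<circ> e) * W"
  proof (rule eq_matI)
    fix k l assume "k < dim_row (?D (f \<circ> e) * W)" "l < dim_col (?D (f \<circ> e) * W)"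
    then have kl: "k < n" "l < n" using W by (auto simp: mat_diag_def)
    have a: "(W * ?D d) $$ (k,l) = W $$ (k,l) * complex_of_real (d l)" for d
      using W kl by (simp add: mat_diag_mult_right)
    have b: "(?D d * W) $$ (k,l) = complex_of_real (d k) * W $$ (k,l)" for d
      using W kl by (simp add: mat_diag_mult_left)
    have "W $$ (k,l) = 0 \<or> d l = e k" using a[of d] b[of e] comm by auto
    then show "(W * ?D (f \<circ> d)) $$ (k,l) = (?D (f \<circ> e) * W) $$ (k,l)"
      using a[of "f \<circ> d"] b[of "f \<circ> e"] by auto
  qed (use W in \<open>auto simp: mat_diag_def\<close>)
  then have "V * (W * ?D (f \<circ> d)) * ?U' = V * (?D (f \<circ> e) * W) * ?U'" by simp
  moreover have "V * (W * ?D (f \<circ> d)) = U * ?D (f \<circ> d)"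
    using assoc[OF c(2) W cD] VW by simp
  moreover have "V * (?D (f \<circ> e) * W) * ?U' = V * ?D (f \<circ> e) * ?V'"
  proof -
    have "V * (?D (f \<circ> e) * W) * ?U' = V * ?D (f \<circ> e) * W * ?U'"
      using assoc[OF c(2) cD W] by simp
    also have "\<dots> = V * ?D (f \<circ> e) * (W * ?U')"
      by (rule assoc; intro m c cD W)
    finally show ?thesis using WU by simp
  qed
  ultimately show ?thesis unfolding spectral_form_def by simp
qed

lemma mat_fun_spectral_form:
  assumes U: "unitary_mat n U"
  shows "mat_fun f (spectral_form n U d) = spectral_form n U (f \<circ> d)"
proof -
  have [simp]: "dim_row (spectral_form n U d) = n" using spectral_form_carrier[OF U] by auto
  show ?thesis unfolding mat_fun_def
  proof (rule the_equality)
    fix B assume "\<exists>V e. unitary_mat (dim_row (spectral_form n U d)) V \<and>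
      spectral_form n U d = spectral_form (dim_row (spectral_form n U d)) V e \<and>
      B = spectral_form (dim_row (spectral_form n U d)) V (f \<circ> e)"
    then obtain V e where "unitary_mat n V" "spectral_form n U d = spectral_form n V e"
      "B = spectral_form n V (f \<circ> e)" by auto
    then show "B = spectral_form n U (f \<circ> d)" using spectral_form_unique[OF U] by simp
  qed (use U in auto)
qed

definition matrix_monotone :: "(real \<Rightarrow> real) \<Rightarrow> bool" where
  "matrix_monotone f \<longleftrightarrow> (\<forall>n A B. positive_def n A \<longrightarrow> positive_def n B \<longrightarrow>
     loewner_le n A B \<longrightarrow> loewner_le n (mat_fun f A) (mat_fun f B))"

text \<open>Functions on the positive half-line are rendered as total functions on the reals; their
  values outside of it are irrelevant.\<close>

definition standard_matrix_monotone :: "(real \<Rightarrow> real) \<Rightarrow> bool" where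
  "standard_matrix_monotone f \<longleftrightarrow> (\<forall>t>0. 0 < f t) \<and> matrix_monotone f \<and>
     f 1 = 1 \<and> (\<forall>t>0. t * f (1 / t) = f t)"

definition mean_fun :: "(real \<Rightarrow> real) \<Rightarrow> real \<Rightarrow> real \<Rightarrow> real" where
  "mean_fun f x y = x * f (y / x)"

definition hadamard :: "complex mat \<Rightarrow> complex mat \<Rightarrow> complex mat" where
  "hadamard A B = mat (dim_row A) (dim_col A) (\<lambda>(i,j). A $$ (i,j) * B $$ (i,j))"

definition linear_mat_map :: "nat \<Rightarrow> nat \<Rightarrow> (complex mat \<Rightarrow> complex mat) \<Rightarrow> bool" where
  "linear_mat_map n m \<Phi> \<longleftrightarrow>
     (\<forall>A \<in> carrier_mat n n. \<Phi> A \<in> carrier_mat m m) \<and>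
     (\<forall>A \<in> carrier_mat n n. \<forall>B \<in> carrier_mat n n. \<Phi> (A + B) = \<Phi> A + \<Phi> B) \<and>
     (\<forall>c. \<forall>A \<in> carrier_mat n n. \<Phi> (c \<cdot>\<^sub>m A) = c \<cdot>\<^sub>m \<Phi> A)"

text \<open>A \<open>k * n\<close> by \<open>k * n\<close> matrix is viewed as a \<open>k\<close> by \<open>k\<close> matrix of \<open>n\<close> by \<open>n\<close> blocks;
  \<open>ampliation k n m \<Phi>\<close> is the tensor product of the identity on the \<open>k\<close> by \<open>k\<close> matrices with \<open>\<Phi>\<close>,
  that is, it applies \<open>\<Phi>\<close> to each block.\<close>

definition mat_block :: "nat \<Rightarrow> complex mat \<Rightarrow> nat \<Rightarrow> nat \<Rightarrow> complex mat" where
  "mat_block n X p q = mat n n (\<lambda>(i,j). X $$ (p * n + i, q * n + j))"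

definition ampliation ::
  "nat \<Rightarrow> nat \<Rightarrow> nat \<Rightarrow> (complex mat \<Rightarrow> complex mat) \<Rightarrow> complex mat \<Rightarrow> complex mat" where
  "ampliation k n m \<Phi> X = mat (k * m) (k * m)
     (\<lambda>(r,s). \<Phi> (mat_block n X (r div m) (s div m)) $$ (r mod m, s mod m))"

definition completely_positive :: "nat \<Rightarrow> nat \<Rightarrow> (complex mat \<Rightarrow> complex mat) \<Rightarrow> bool" where
  "completely_positive n m \<Phi> \<longleftrightarrow> linear_mat_map n m \<Phi> \<and>
     (\<forall>k X. positive_semidef (k * n) X \<longrightarrow> positive_semidef (k * m) (ampliation k n m \<Phi> X))"

end

theory Submission
  imports Defs
begin

text \<open>The map \<open>A \<mapsto> A \<circ> T\<close> is a Schur multiplier, and complete positivity of Schur multipliers is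
  governed by the Schur product theorem.

  If the map is completely positive, it is in particular positive. The all-ones matrix \<open>J\<close> is
  positive, being \<open>1 1\<^sup>*\<close>, and it is the unit of the Hadamard product, so \<open>T = J \<circ> T\<close> is positive.

  Conversely, applying the map to every block of a \<open>k n\<close> by \<open>k n\<close> matrix \<open>X\<close> multiplies \<open>X\<close>
  entrywise with \<open>J\<^sub>k \<otimes> T\<close>, whose entry at \<open>(r, s)\<close> is \<open>T\<close> at \<open>(r mod n, s mod n)\<close>. A positive \<open>T\<close>
  is a Gram matrix (\<open>psd_kernel_imp_gram\<close>, by successive Schur complements as in the Cholesky
  factorization), and then \<open>J\<^sub>k \<otimes> T\<close> is the Gram matrix of the same vectors, each repeated \<open>k\<close>
  times. The entrywise product of a positive matrix with a Gram matrix is a sum of diagonal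
  congruences \<open>D\<^sup>* X D\<close> of it, hence positive (\<open>schur_product_gram\<close>).

  All of this concerns finite index sets only, so positivity is treated for kernels on a finite
  set; removing one index at a time is then ordinary induction on finite sets.\<close>

definition psd_kernel :: "'a set \<Rightarrow> ('a \<Rightarrow> 'a \<Rightarrow> complex) \<Rightarrow> bool" where
  "psd_kernel I K \<longleftrightarrow> (\<forall>c. 0 \<le> (\<Sum>i\<in>I. \<Sum>j\<in>I. K i j * c j * cnj (c i)))"

lemma psd_kernel_subset:
  assumes "psd_kernel J K" "I \<subseteq> J" "finite J"
  shows "psd_kernel I K"
  unfolding psd_kernel_def
proof
  fix c :: "'a \<Rightarrow> complex"
  define c' where "c' i = (if i \<in> I then c i else 0)" for i
  have "(\<Sum>i\<in>J. \<Sum>j\<in>J. K i j * c' j * cnj (c' i)) = (\<Sum>i\<in>I. \<Sum>j\<in>J. K i j * c' j * cnj (c' i))"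
    using assms by (intro sum.mono_neutral_right) (auto simp: c'_def)
  also have "\<dots> = (\<Sum>i\<in>I. \<Sum>j\<in>I. K i j * c' j * cnj (c' i))"
    using assms by (intro sum.cong refl sum.mono_neutral_right) (auto simp: c'_def)
  also have "\<dots> = (\<Sum>i\<in>I. \<Sum>j\<in>I. K i j * c j * cnj (c i))"
    by (intro sum.cong) (auto simp: c'_def)
  finally show "0 \<le> (\<Sum>i\<in>I. \<Sum>j\<in>I. K i j * c j * cnj (c i))"
    using assms(1) unfolding psd_kernel_def by metis
qed

lemma psd_kernel_diag_nonneg:
  assumes "psd_kernel I K" "finite I" "a \<in> I"
  shows "0 \<le> K a a"
proof -
  have "psd_kernel {a} K" using psd_kernel_subset[of I K "{a}"] assms by auto
  then show ?thesis unfolding psd_kernel_def by (auto dest: spec[of _ "\<lambda>_. 1"])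
qed

lemma psd_kernel_two_point:
  assumes "psd_kernel I K" "finite I" "a \<in> I" "b \<in> I" "a \<noteq> b"
  shows "0 \<le> K a a * x * cnj x + K a b * y * cnj x + K b a * x * cnj y + K b b * y * cnj y"
proof -
  have "psd_kernel {a, b} K" using psd_kernel_subset[of I K "{a, b}"] assms by auto
  then have "0 \<le> (\<Sum>i\<in>{a, b}. \<Sum>j\<in>{a, b}.
      K i j * (if j = a then x else y) * cnj (if i = a then x else y))"
    unfolding psd_kernel_def by (rule spec)
  then show ?thesis using assms(5) by (simp add: add_ac)
qed

text \<open>The quadratic form is real at \<open>e\<^sub>a + e\<^sub>b\<close> and at \<open>e\<^sub>a + \<i> e\<^sub>b\<close>; the two imaginary parts give the two
  components of the identity.\<close>

lemma psd_kernel_hermitian: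
  assumes "psd_kernel I K" "finite I" "a \<in> I" "b \<in> I"
  shows "K b a = cnj (K a b)"
proof (cases "a = b")
  case True
  then show ?thesis using psd_kernel_diag_nonneg[OF assms(1-3)]
    by (auto simp: less_eq_complex_def complex_eq_iff)
next
  case False
  note tp = psd_kernel_two_point[OF assms False]
  show ?thesis
    using tp[of 1 1] tp[of 1 \<i>] psd_kernel_diag_nonneg[OF assms(1-3)]
      psd_kernel_diag_nonneg[OF assms(1,2,4)]
    by (auto simp: less_eq_complex_def complex_eq_iff)
qed

lemma psd_kernel_zero_diag:
  assumes "psd_kernel I K" "finite I" "a \<in> I" "b \<in> I" and zero: "K a a = 0"
  shows "K b a = 0"
proof (rule ccontr)
  assume nz: "K b a \<noteq> 0"
  with zero have "a \<noteq> b" by auto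
  define d where "d = K b b"
  have d: "0 \<le> d" unfolding d_def by (rule psd_kernel_diag_nonneg[OF assms(1,2,4)])
  have h: "K a b = cnj (K b a)" by (rule psd_kernel_hermitian[OF assms(1,2,4,3)])
  \<comment> \<open>Without a diagonal term at \<open>a\<close>, the form at \<open>x e\<^sub>a + e\<^sub>b\<close> is \<open>d + 2 Re (K b a x)\<close>, which is
    unbounded below in \<open>x\<close>; this \<open>x\<close> makes it \<open>-d - 2\<close>.\<close>
  define x where "x = - (d + 1) / K b a"
  have x: "K b a * x = - (d + 1)" using nz by (simp add: x_def)
  have "K a b * cnj x = cnj (K b a * x)" using h by simp
  also have "\<dots> = - (d + 1)" using x d by (simp add: less_eq_complex_def complex_eq_iff)
  finally have x': "K a b * cnj x = - (d + 1)" .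
  show False
    using psd_kernel_two_point[OF assms(1-4) \<open>a \<noteq> b\<close>, of x 1] zero x x' d
    by (auto simp: d_def[symmetric] less_eq_complex_def)
qed

text \<open>Minimizing the quadratic form over the coefficient at \<open>a\<close> leaves the quadratic form of the
  Schur complement. If \<open>K a a = 0\<close>, the division yields 0, which is the right value because column
  \<open>a\<close> vanishes.\<close>

lemma psd_kernel_schur_complement:
  assumes psd: "psd_kernel (insert a I) K" and fin: "finite I" and a: "a \<notin> I"
  shows "psd_kernel I (\<lambda>i j. K i j - K i a * K a j / K a a)"
proof (cases "K a a = 0")
  case True
  then show ?thesis using psd_kernel_subset[OF psd, of I] fin by auto
next
  case False
  have fin': "finite (insert a I)" using fin by simp
  have re: "cnj (K a a) = K a a"
    using psd_kernel_hermitian[OF psd fin', of a a] by simp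
  show ?thesis unfolding psd_kernel_def
  proof
    fix c :: "'a \<Rightarrow> complex"
    define S where "S = (\<Sum>j\<in>I. K a j * c j)"
    define t where "t = - S / K a a"
    define Q where "Q = (\<Sum>i\<in>I. \<Sum>j\<in>I. K i j * c j * cnj (c i))"
    define e where "e = c(a := t)"
    have S': "(\<Sum>i\<in>I. K i a * cnj (c i)) = cnj S"
      unfolding S_def cnj_sum
      by (intro sum.cong refl) (use psd_kernel_hermitian[OF psd fin', of a] in auto)
    have ea: "e a = t" and eI: "i \<in> I \<Longrightarrow> e i = c i" for i
      using a by (auto simp: e_def)
    have "0 \<le> (\<Sum>i\<in>insert a I. \<Sum>j\<in>insert a I. K i j * e j * cnj (e i))"
      using psd unfolding psd_kernel_def by blast
    also have "\<dots> = K a a * t * cnj t + (\<Sum>j\<in>I. K a j * e j) * cnj t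
        + ((\<Sum>i\<in>I. K i a * cnj (e i)) * t + (\<Sum>i\<in>I. \<Sum>j\<in>I. K i j * e j * cnj (e i)))"
      using fin a
      by (simp add: ea sum.distrib sum_distrib_right mult.assoc mult.commute[of t])
    also have "(\<Sum>j\<in>I. K a j * e j) = S" unfolding S_def by (intro sum.cong) (auto simp: eI)
    also have "(\<Sum>i\<in>I. K i a * cnj (e i)) = cnj S"
      unfolding S'[symmetric] by (intro sum.cong) (auto simp: eI)
    also have "(\<Sum>i\<in>I. \<Sum>j\<in>I. K i j * e j * cnj (e i)) = Q"
      unfolding Q_def by (intro sum.cong) (auto simp: eI)
    also have "K a a * t * cnj t + S * cnj t + (cnj S * t + Q) = Q - cnj S * S / K a a"
      using False by (simp add: t_def re field_simps)
    also have "cnj S * S = (\<Sum>i\<in>I. K i a * cnj (c i)) * (\<Sum>j\<in>I. K a j * c j)"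
      by (simp only: S' S_def[symmetric])
    also have "\<dots> / K a a = (\<Sum>i\<in>I. \<Sum>j\<in>I. K i a * K a j / K a a * c j * cnj (c i))"
      unfolding sum_product sum_divide_distrib by (intro sum.cong refl) simp
    also have "Q - \<dots> = (\<Sum>i\<in>I. \<Sum>j\<in>I. (K i j - K i a * K a j / K a a) * c j * cnj (c i))"
      unfolding Q_def by (simp add: sum_subtractf left_diff_distrib)
    finally show "0 \<le> (\<Sum>i\<in>I. \<Sum>j\<in>I. (K i j - K i a * K a j / K a a) * c j * cnj (c i))" .
  qed
qed

lemma psd_kernel_imp_gram:
  assumes "finite I" "psd_kernel I K"
  shows "\<exists>g. \<forall>i\<in>I. \<forall>j\<in>I. K i j = (\<Sum>l\<in>I. g l i * cnj (g l j))"
  using assms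
proof (induction I arbitrary: K rule: finite_induct)
  case empty
  then show ?case by simp
next
  case (insert a I)
  have fin: "finite (insert a I)" using insert.hyps by simp
  obtain g where g: "\<And>i j. i \<in> I \<Longrightarrow> j \<in> I \<Longrightarrow>
      K i j - K i a * K a j / K a a = (\<Sum>l\<in>I. g l i * cnj (g l j))"
    using insert.IH[OF psd_kernel_schur_complement[OF insert.prems insert.hyps]] by blast
  have nonneg: "0 \<le> K a a" using psd_kernel_diag_nonneg[OF insert.prems fin] by simp
  define s where "s = complex_of_real (sqrt (Re (K a a)))"
  have s: "s * s = K a a" "cnj s = s"
    using nonneg by (auto simp: s_def less_eq_complex_def complex_eq_iff)
  \<comment> \<open>The rank one part removed by the Schur complement becomes the summand with index
    \<open>a\<close>; the vectors of the other summands get entry 0 at \<open>a\<close>.\<close>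
  define h where "h l i = (if l = a then K i a / s else if i = a then 0 else g l i)" for l i
  have rank1: "h a i * cnj (h a j) = K i a * K a j / K a a" if "j \<in> insert a I" for i j
    using s psd_kernel_hermitian[OF insert.prems fin that, of a] by (simp add: h_def)
  have "K i j = (\<Sum>l\<in>insert a I. h l i * cnj (h l j))"
    if ij: "i \<in> insert a I" "j \<in> insert a I" for i j
  proof -
    have "(\<Sum>l\<in>insert a I. h l i * cnj (h l j))
        = K i a * K a j / K a a + (\<Sum>l\<in>I. h l i * cnj (h l j))"
      using insert.hyps rank1[OF ij(2)] by simp
    also have "\<dots> = K i j"
    proof (cases "i = a \<or> j = a")
      case True
      have "(\<Sum>l\<in>I. h l i * cnj (h l j)) = 0"
        using True insert.hyps by (intro sum.neutral) (auto simp: h_def)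
      moreover have "K i a * K a j / K a a = K i j"
      proof (cases "K a a = 0")
        case True
        then have "K i a = 0" "K j a = 0"
          using psd_kernel_zero_diag[OF insert.prems fin] ij by auto
        then show ?thesis
          using \<open>i = a \<or> j = a\<close> psd_kernel_hermitian[OF insert.prems fin ij(2), of a] by auto
      qed (use True in auto)
      ultimately show ?thesis by simp
    next
      case False
      then have "i \<in> I" "j \<in> I" using ij by auto
      have "(\<Sum>l\<in>I. h l i * cnj (h l j)) = (\<Sum>l\<in>I. g l i * cnj (g l j))"
        using insert.hyps False by (intro sum.cong) (auto simp: h_def)
      then show ?thesis using g[OF \<open>i \<in> I\<close> \<open>j \<in> I\<close>] by (simp add: diff_eq_eq)
    qed
    finally show ?thesis by simp
  qed
  then show ?case by blast
qed

text \<open>With respect to \<open>c\<close>, the form of the product is the sum over \<open>l\<close> of the forms of \<open>L\<close> at the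
  rescaled vectors \<open>cnj (g l j) * c j\<close>.\<close>

lemma schur_product_gram:
  assumes "psd_kernel I L"
    and gram: "\<And>i j. i \<in> I \<Longrightarrow> j \<in> I \<Longrightarrow> K i j = (\<Sum>l\<in>A. g l i * cnj (g l j))"
  shows "psd_kernel I (\<lambda>i j. L i j * K i j)"
  unfolding psd_kernel_def
proof
  fix c :: "'a \<Rightarrow> complex"
  let ?c = "\<lambda>l j. cnj (g l j) * c j"
  have "(\<Sum>i\<in>I. \<Sum>j\<in>I. L i j * K i j * c j * cnj (c i))
      = (\<Sum>i\<in>I. \<Sum>j\<in>I. \<Sum>l\<in>A. L i j * ?c l j * cnj (?c l i))"
    by (intro sum.cong refl)
      (simp add: gram sum_distrib_left sum_distrib_right mult_ac)
  also have "\<dots> = (\<Sum>i\<in>I. \<Sum>l\<in>A. \<Sum>j\<in>I. L i j * ?c l j * cnj (?c l i))"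
    by (intro sum.cong refl sum.swap)
  also have "\<dots> = (\<Sum>l\<in>A. \<Sum>i\<in>I. \<Sum>j\<in>I. L i j * ?c l j * cnj (?c l i))"
    by (rule sum.swap)
  also have "0 \<le> \<dots>"
    by (rule sum_nonneg) (use assms(1) in \<open>simp only: psd_kernel_def\<close>)
  finally show "0 \<le> (\<Sum>i\<in>I. \<Sum>j\<in>I. L i j * K i j * c j * cnj (c i))" .
qed

lemma positive_semidef_iff_psd_kernel:
  assumes A: "A \<in> carrier_mat n n"
  shows "positive_semidef n A \<longleftrightarrow> psd_kernel {0..<n} (\<lambda>i j. A $$ (i,j))"
proof -
  have form: "(A *\<^sub>v v) \<bullet>c v = (\<Sum>i\<in>{0..<n}. \<Sum>j\<in>{0..<n}. A $$ (i,j) * v $ j * cnj (v $ i))"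
    if "v \<in> carrier_vec n" for v
    using A that by (simp add: scalar_prod_def sum_distrib_right)
  have "(\<forall>v\<in>carrier_vec n. 0 \<le> (A *\<^sub>v v) \<bullet>c v) \<longleftrightarrow> psd_kernel {0..<n} (\<lambda>i j. A $$ (i,j))"
  proof
    assume pos: "\<forall>v\<in>carrier_vec n. 0 \<le> (A *\<^sub>v v) \<bullet>c v"
    show "psd_kernel {0..<n} (\<lambda>i j. A $$ (i,j))" unfolding psd_kernel_def
    proof
      fix c :: "nat \<Rightarrow> complex"
      show "0 \<le> (\<Sum>i\<in>{0..<n}. \<Sum>j\<in>{0..<n}. A $$ (i,j) * c j * cnj (c i))"
        using pos[rule_format, of "vec n c"] form[of "vec n c"] by simp
    qed
  qed (auto simp: form psd_kernel_def)
  then show ?thesis using A unfolding positive_semidef_def by simp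
qed

lemma linear_mat_map_hadamard:
  assumes "T \<in> carrier_mat n n"
  shows "linear_mat_map n n (\<lambda>A. hadamard A T)"
  using assms unfolding linear_mat_map_def hadamard_def
  by (auto intro!: eq_matI simp: algebra_simps)

lemma ampliation_hadamard:
  assumes "r < k * n" "s < k * n" and T: "T \<in> carrier_mat n n"
    and X: "X \<in> carrier_mat (k * n) (k * n)"
  shows "ampliation k n n (\<lambda>A. hadamard A T) X $$ (r,s) = X $$ (r,s) * T $$ (r mod n, s mod n)"
proof -
  have "n > 0" using assms(1) by (cases n) auto
  then show ?thesis using assms by (simp add: ampliation_def hadamard_def mat_block_def)
qed

theorem completely_positive_hadamard_iff:
  assumes T: "T \<in> carrier_mat n n"
  shows "completely_positive n n (\<lambda>A. hadamard A T) \<longleftrightarrow> positive_semidef n T"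
proof
  assume cp: "completely_positive n n (\<lambda>A. hadamard A T)"
  define J :: "complex mat" where "J = mat n n (\<lambda>_. 1)"
  have J: "J \<in> carrier_mat (1 * n) (1 * n)" by (simp add: J_def)
  have "psd_kernel {0..<1 * n} (\<lambda>i j. J $$ (i,j))"
    unfolding psd_kernel_def
  proof
    fix c :: "nat \<Rightarrow> complex"
    let ?S = "\<Sum>j\<in>{0..<n}. c j"
    have "(\<Sum>i\<in>{0..<1 * n}. \<Sum>j\<in>{0..<1 * n}. J $$ (i,j) * c j * cnj (c i)) = cnj ?S * ?S"
      unfolding cnj_sum sum_product by (simp add: J_def mult.commute)
    also have "0 \<le> cnj ?S * ?S"
      by (simp add: complex_mult_cnj mult.commute[of "cnj ?S"] less_eq_complex_def
          del: cnj_sum)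
    finally show "0 \<le> (\<Sum>i\<in>{0..<1 * n}. \<Sum>j\<in>{0..<1 * n}. J $$ (i,j) * c j * cnj (c i))" .
  qed
  then have "positive_semidef (1 * n) J" using positive_semidef_iff_psd_kernel[OF J] by blast
  then have "positive_semidef (1 * n) (ampliation 1 n n (\<lambda>A. hadamard A T) J)"
    using cp unfolding completely_positive_def by blast
  moreover have "ampliation 1 n n (\<lambda>A. hadamard A T) J = T"
  proof (rule eq_matI)
    fix i j assume "i < dim_row T" "j < dim_col T"
    then have "i < n" "j < n" using T by auto
    then show "ampliation 1 n n (\<lambda>A. hadamard A T) J $$ (i,j) = T $$ (i,j)"
      using ampliation_hadamard[of i 1 n j, OF _ _ T J] by (simp add: J_def)
  qed (use T in \<open>auto simp: ampliation_def\<close>)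
  ultimately show "positive_semidef n T" by simp
next
  assume "positive_semidef n T"
  then obtain g where g: "\<And>i j. i < n \<Longrightarrow> j < n \<Longrightarrow>
      T $$ (i,j) = (\<Sum>l\<in>{0..<n}. g l i * cnj (g l j))"
    using psd_kernel_imp_gram[of "{0..<n}"] positive_semidef_iff_psd_kernel[OF T]
    by fastforce
  show "completely_positive n n (\<lambda>A. hadamard A T)"
    unfolding completely_positive_def
  proof (intro conjI allI impI linear_mat_map_hadamard[OF T])
    fix k X assume pos: "positive_semidef (k * n) X"
    let ?Y = "ampliation k n n (\<lambda>A. hadamard A T) X"
    have X: "X \<in> carrier_mat (k * n) (k * n)" using pos unfolding positive_semidef_def by blast
    have Y: "?Y \<in> carrier_mat (k * n) (k * n)" by (simp add: ampliation_def)
    have "psd_kernel {0..<k * n} (\<lambda>r s. X $$ (r,s) * T $$ (r mod n, s mod n))"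
    proof (rule schur_product_gram)
      show "psd_kernel {0..<k * n} (\<lambda>r s. X $$ (r,s))"
        using pos positive_semidef_iff_psd_kernel[OF X] by blast
    next
      fix r s assume "r \<in> {0..<k * n}" "s \<in> {0..<k * n}"
      then have "n > 0" by (cases n) auto
      then show "T $$ (r mod n, s mod n)
          = (\<Sum>l\<in>{0..<n}. g l (r mod n) * cnj (g l (s mod n)))"
        by (intro g) auto
    qed
    then have "psd_kernel {0..<k * n} (\<lambda>r s. ?Y $$ (r,s))"
      by (simp add: psd_kernel_def ampliation_hadamard[OF _ _ T X])
    then show "positive_semidef (k * n) ?Y" using positive_semidef_iff_psd_kernel[OF Y] by blast
  qed
qed

theorem lemma1:
  fixes f :: "real \<Rightarrow> real" and n :: nat and lam :: "nat \<Rightarrow> real" and T :: "complex mat"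
  assumes "standard_matrix_monotone f"
    and "\<And>i. i < n \<Longrightarrow> 0 < lam i"
    and "T = mat n n (\<lambda>(i,j). complex_of_real (1 / mean_fun f (lam i) (lam j)))"
  shows "completely_positive n n (\<lambda>A. hadamard A T) \<longleftrightarrow> positive_semidef n T"
  by (rule completely_positive_hadamard_iff) (simp add: assms(3))

end
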